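(* Let $p$ be a prime, let $m>1$ be an integer and put $q=pm$. Let $\mathcal{B}\subset \mathbb{Z}_q$ with $|\mathcal{B}|=n$. Suppose that the reduction of $\mathcal{B}$ modulo $p$ (that is, the image of $\mathcal{B}$ under the natural map $\mathbb{Z}_q\to\mathbb{Z}_p$) has more than $4\lceil 2\sqrt{p}\rceil$ elements, and assume that at least one element of $\mathcal{B}$ is not a multiple of $m$. Then there is a subset $\mathcal{A}\subset\mathcal{B}$ with $\Sigma(\mathcal{A})\equiv 0 \pmod p$ and $\Sigma(\mathcal{A})\not\equiv 0 \pmod q$.
   Context: $\mathbb{Z}_q$ denotes $\mathbb{Z}/q\mathbb{Z}$. For a finite set $\mathcal{A}$, $\Sigma(\mathcal{A})=\sum_{a\in\mathcal{A}} a$. Since $p\mid q$ and $m\mid q$, reduction modulo $p$ and being a multiple of $m$ are well defined for elements of $\mathbb{Z}_q$. $\lceil x\rceil$ is the smallest integer at least $x$. *)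

theory Defs
  imports "HOL-Number_Theory.Number_Theory"
begin

text \<open>
  The ring of integers modulo \<open>q\<close> is \<open>residue_ring q\<close>, whose carrier consists of the
  canonical representatives \<open>{0..q - 1}\<close>. When \<open>p\<close> divides \<open>q\<close>, the natural map to
  \<open>residue_ring p\<close> sends a representative \<open>b\<close> to \<open>b mod p\<close>.
\<close>

definition residue_sum :: "int \<Rightarrow> int set \<Rightarrow> int" where
  "residue_sum q A = finsum (residue_ring q) (\<lambda>a. a) A"

lemma residue_sum_eq:
  assumes "q > 1" and "A \<subseteq> carrier (residue_ring q)"
  shows "residue_sum q A = (\<Sum>a\<in>A. a) mod q"
proof -
  interpret residues q "residue_ring q"
    using assms(1) by unfold_locales auto
  have "finite A"
    using assms(2) finite_subset by (auto simp: residue_ring_def)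
  from this assms(2) have "finsum (residue_ring q) (\<lambda>a. a) A = (\<Sum>a\<in>A. a) mod q"
  proof (induction A rule: finite_induct)
    case empty
    then show ?case by (simp add: res_zero_eq)
  next
    case (insert x F)
    then have "finsum (residue_ring q) (\<lambda>a. a) (insert x F) = x \<oplus>\<^bsub>residue_ring q\<^esub> finsum (residue_ring q) (\<lambda>a. a) F"
      by (intro finsum_insert) auto
    with insert show ?case by (simp add: res_add_eq mod_simps)
  qed
  then show ?thesis by (simp add: residue_sum_def)
qed

end

theory Submission
  imports Defs
begin

text \<open>
  Suppose that every subset of \<open>B\<close> with sum zero modulo \<open>p\<close> has sum zero modulo \<open>q\<close>, and let
  \<open>b \<in> B\<close> be no multiple of \<open>m\<close>. If \<open>B - {b}\<close> contains two disjoint sets, each having subset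
  sums in all residue classes modulo \<open>p\<close>, then comparing sums that add up to zero yields
  subsets of the first set with sums \<open>0, b, 2 * b, \<dots>, p * b\<close> modulo \<open>q\<close>, up to a common
  shift. The first and the last of these vanish modulo \<open>p\<close>, hence modulo \<open>q\<close>, so \<open>q\<close> divides
  \<open>p * b\<close>, which is impossible.

  To find such sets, one adds elements greedily. For a set \<open>X\<close> of \<open>c \<le> p / 2\<close> residues let
  \<open>\<lambda>(x)\<close> be the number of \<open>y \<in> X\<close> with \<open>y + x \<notin> X\<close>. This function is subadditive, so if it
  is at most \<open>M\<close> on many elements, the Cauchy-Davenport theorem produces so many elements with
  \<open>\<lambda> \<le> j * M\<close> that the average of \<open>\<lambda>\<close> becomes too small. Therefore the number of subset
  sums of \<open>N\<close> well-chosen elements is about \<open>N\<^sup>2 / 4\<close> as long as it stays below \<open>p / 2\<close>, and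
  two sets with more than \<open>p / 2\<close> subset sums together reach all residues.
\<close>

section \<open>Sets of residues modulo \<open>p\<close>\<close>

locale prime_modulus =
  fixes p :: int
  assumes prime_p: "prime p"
begin

text \<open>A set of residues is encoded as the union of its classes in the integers, so that sums
  and translates need no reduction modulo \<open>p\<close>.\<close>

definition periodic :: "int set \<Rightarrow> bool" where
  "periodic X \<longleftrightarrow> (\<forall>x. x mod p \<in> X \<longleftrightarrow> x \<in> X)"

definition size_mod :: "int set \<Rightarrow> nat" where
  "size_mod X = card (X \<inter> {0..<p})"

lemma p_pos: "p > 0"
  using prime_p by (simp add: prime_gt_0_int)

lemma periodic_mem_iff:
  assumes "periodic X" and "x mod p = y mod p"
  shows "x \<in> X \<longleftrightarrow> y \<in> X"
  using assms unfolding periodic_def by metis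

lemma periodic_translate:
  assumes "periodic X"
  shows "periodic {x. x + c \<in> X}"
  unfolding periodic_def mem_Collect_eq
  by (intro allI periodic_mem_iff[OF assms]) (simp add: mod_simps)

lemma periodic_Un: "periodic X \<Longrightarrow> periodic Y \<Longrightarrow> periodic (X \<union> Y)"
  and periodic_Int: "periodic X \<Longrightarrow> periodic Y \<Longrightarrow> periodic (X \<inter> Y)"
  and periodic_Compl: "periodic X \<Longrightarrow> periodic (- X)"
  by (simp_all add: periodic_def)

lemma size_mod_mono: "X \<subseteq> Y \<Longrightarrow> size_mod X \<le> size_mod Y"
  unfolding size_mod_def by (intro card_mono) auto

lemma size_mod_UNIV [simp]: "size_mod UNIV = nat p"
  by (simp add: size_mod_def)

lemma size_mod_le: "size_mod X \<le> nat p"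
  using size_mod_mono[of X UNIV] by simp

lemma size_mod_Un_disjoint: "X \<inter> Y = {} \<Longrightarrow> size_mod (X \<union> Y) = size_mod X + size_mod Y"
  unfolding size_mod_def Int_Un_distrib2 by (rule card_Un_disjoint) auto

lemma size_mod_Un_le: "size_mod (X \<union> Y) \<le> size_mod X + size_mod Y"
  unfolding size_mod_def Int_Un_distrib2 by (rule card_Un_le)

lemma size_mod_split: "size_mod X = size_mod (X \<inter> Y) + size_mod (X - Y)"
  using size_mod_Un_disjoint[of "X \<inter> Y" "X - Y"] by (simp add: Int_Diff_Un Int_Diff_disjoint)

lemma size_mod_pos:
  assumes "periodic X" and "X \<noteq> {}"
  shows "size_mod X > 0"
proof -
  obtain x where "x \<in> X"
    using assms(2) by auto
  then have "x mod p \<in> X \<inter> {0..<p}"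
    using assms(1) p_pos by (auto simp: periodic_def)
  then show ?thesis
    unfolding size_mod_def by (auto simp: card_gt_0_iff)
qed

lemma size_mod_translate:
  assumes "periodic X"
  shows "size_mod {x. x + c \<in> X} = size_mod X"
proof -
  have mem: "(x + c) mod p \<in> X \<longleftrightarrow> x + c \<in> X" "(x - c) mod p + c \<in> X \<longleftrightarrow> x \<in> X" for x
    by (rule periodic_mem_iff[OF assms], simp add: mod_simps)+
  have "bij_betw (\<lambda>x. (x + c) mod p) ({x. x + c \<in> X} \<inter> {0..<p}) (X \<inter> {0..<p})"
  proof (rule bij_betw_byWitness[where f' = "\<lambda>x. (x - c) mod p"])
    show "(\<lambda>x. (x + c) mod p) ` ({x. x + c \<in> X} \<inter> {0..<p}) \<subseteq> X \<inter> {0..<p}"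
      "(\<lambda>x. (x - c) mod p) ` (X \<inter> {0..<p}) \<subseteq> {x. x + c \<in> X} \<inter> {0..<p}"
      using mem p_pos by auto
  qed (simp_all add: mod_simps)
  then show ?thesis
    unfolding size_mod_def by (rule bij_betw_same_card)
qed

section \<open>The Cauchy-Davenport theorem\<close>

text \<open>As \<open>d\<close> is invertible modulo \<open>p\<close>, repeated shifts by
  \<open>d\<close> lead from one element to every class.\<close>

lemma periodic_shift_closed_UNIV:
  assumes "periodic A" and "A \<noteq> {}" and "\<not> p dvd d" and closed: "\<And>a. a \<in> A \<Longrightarrow> a + d \<in> A"
  shows "A = UNIV"
proof -
  obtain a where a: "a \<in> A"
    using assms(2) by auto
  have mult: "a + int n * d \<in> A" for n
  proof (induction n)
    case (Suc n)
    from closed[OF this] show ?case by (simp add: algebra_simps)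
  qed (simp add: a)
  have "coprime d p"
    using prime_p assms(3) by (metis coprime_commute prime_imp_coprime)
  have "x \<in> A" for x
  proof -
    obtain u where "[d * u = 1] (mod p)"
      using \<open>coprime d p\<close> cong_solve_coprime_int by blast
    then have u: "[d * (u * (x - a)) = x - a] (mod p)"
      by (metis cong_scalar_right mult.assoc mult_1)
    define n where "n = nat (u * (x - a) mod p)"
    have "[a + int n * d = a + d * (u * (x - a))] (mod p)"
      using p_pos by (simp add: n_def cong_def mult.commute[of _ d]) (metis mod_add_right_eq mod_mult_right_eq)
    also have "[a + d * (u * (x - a)) = a + (x - a)] (mod p)"
      using u by (simp only: cong_add_lcancel)
    finally have "[a + int n * d = x] (mod p)"
      by simp
    with mult show ?thesis
      using periodic_mem_iff[OF assms(1)] unfolding cong_def by blast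
  qed
  then show ?thesis by auto
qed

text \<open>
  Induction on \<open>C\<close> with the \<open>e\<close>-transform, which moves the elements \<open>c\<close> of \<open>C\<close> with
  \<open>c + e \<notin> A\<close> over to \<open>A\<close>.
\<close>

lemma cauchy_davenport:
  assumes "periodic A" "periodic C" "A \<noteq> {}" "C \<noteq> {}"
    and "\<And>a c. a \<in> A \<Longrightarrow> c \<in> C \<Longrightarrow> a + c \<in> D"
  shows "min (nat p) (size_mod A + size_mod C - 1) \<le> size_mod D"
  using assms
proof (induction "size_mod C" arbitrary: A C rule: less_induct)
  case less
  obtain c where c: "c \<in> C"
    using less.prems by auto
  have "{x. x + - c \<in> A} \<subseteq> D"
    using less.prems(5) c by fastforce
  then have sub: "size_mod A \<le> size_mod D"
    using size_mod_mono size_mod_translate[OF less.prems(1), of "- c"] by metis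
  consider "A = UNIV" | "size_mod C = 1" | "A \<noteq> UNIV" "size_mod C > 1"
    using size_mod_pos[OF less.prems(2,4)] by linarith
  then show ?case
  proof cases
    case 3
    then obtain c1 c2 where c12: "c1 \<in> C \<inter> {0..<p}" "c2 \<in> C \<inter> {0..<p}" "c1 \<noteq> c2"
      unfolding size_mod_def by (metis card_1_singleton_iff card_le_Suc0_iff_eq finite_Int finite_atLeastLessThan_int
          linorder_not_less One_nat_def)
    then have "\<not> p dvd c2 - c1"
      by (auto simp: mod_eq_dvd_iff[symmetric])
    then obtain a where a: "a \<in> A" "a + (c2 - c1) \<notin> A"
      using periodic_shift_closed_UNIV less.prems(1,3) 3(1) by blast
    \<comment> \<open>With this \<open>e\<close>, the element \<open>c1\<close> stays in
      \<open>C'\<close> because \<open>c1 + e = a\<close>, while \<open>c2\<close> leaves it. Thus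
      \<open>C'\<close> is nonempty and smaller than \<open>C\<close>.\<close>
    define e where "e = a - c1"
    define A' where "A' = A \<union> {x. x + - e \<in> C}"
    define C' where "C' = C \<inter> {x. x + e \<in> A}"
    have c1: "c1 \<in> C'" and c2: "c2 \<in> C - {x. x + e \<in> A}"
      using a c12 by (auto simp: C'_def e_def algebra_simps)
    have per: "periodic A'" "periodic C'" "periodic (C - {x. x + e \<in> A})"
      using less.prems(1,2) periodic_translate[OF less.prems(2), of "- e"]
      by (auto simp: A'_def C'_def Diff_eq
          intro!: periodic_Un periodic_Int periodic_translate periodic_Compl simp del: Compl_iff)
    have C: "size_mod C = size_mod C' + size_mod (C - {x. x + e \<in> A})"
      unfolding C'_def by (rule size_mod_split)
    have "A' = A \<union> {x. x + - e \<in> C - {x. x + e \<in> A}}"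
      by (auto simp: A'_def)
    moreover have "A \<inter> {x. x + - e \<in> C - {x. x + e \<in> A}} = {}"
      by auto
    ultimately have "size_mod A' = size_mod A + size_mod (C - {x. x + e \<in> A})"
      using size_mod_Un_disjoint size_mod_translate[OF per(3)] by metis
    with C have sizes: "size_mod A' + size_mod C' = size_mod A + size_mod C"
      by simp
    have "size_mod C' < size_mod C"
      using C size_mod_pos[OF per(3)] c2 by force
    moreover have "x + y \<in> D" if "x \<in> A'" "y \<in> C'" for x y
      using that less.prems(5)[of x y] less.prems(5)[of "y + e" "x - e"] by (auto simp: A'_def C'_def add.commute)
    ultimately have "min (nat p) (size_mod A' + size_mod C' - 1) \<le> size_mod D"
      using less.hyps[OF _ per(1,2)] less.prems(3) c1 by (metis A'_def Un_empty emptyE)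
    then show ?thesis
      using sizes by simp
  qed (use sub size_mod_le in auto)
qed

section \<open>Elements that leave a set under translation\<close>

definition escape :: "int set \<Rightarrow> int \<Rightarrow> nat" where
  "escape B x = size_mod {y \<in> B. y + x \<notin> B}"

lemma escape_eq_diff: "escape B x = size_mod B - size_mod {y \<in> B. y + x \<in> B}"
proof -
  have "{y \<in> B. y + x \<in> B} = B \<inter> {y. y + x \<in> B}" "{y \<in> B. y + x \<notin> B} = B - {y. y + x \<in> B}"
    by auto
  then show ?thesis
    using size_mod_split[of B "{y. y + x \<in> B}"] by (simp add: escape_def)
qed

text \<open>The translate of \<open>B\<close> by \<open>x\<close> contributes exactly the images of
  those elements of \<open>B\<close> that leave \<open>B\<close>.\<close>

lemma size_mod_Un_translate:
  assumes "periodic B"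
  shows "size_mod (B \<union> {y. y - x \<in> B}) = size_mod B + escape B x"
proof -
  let ?E = "{y \<in> B. y + x \<notin> B}"
  have "?E = B \<inter> - {y. y + x \<in> B}"
    by auto
  then have per: "periodic ?E"
    using assms by (simp add: periodic_Int periodic_Compl periodic_translate del: Compl_iff)
  have "B \<union> {y. y - x \<in> B} = B \<union> {y. y + - x \<in> ?E}"
    by auto
  then show ?thesis
    using size_mod_translate[OF per, of "- x"] size_mod_Un_disjoint[of B "{y. y + - x \<in> ?E}"]
    by (simp add: escape_def disjoint_iff)
qed

text \<open>If \<open>y\<close> leaves \<open>B\<close> under the shift by \<open>x + z\<close>,
  then \<open>y\<close> leaves under \<open>x\<close>, or \<open>y + x\<close> lies in
  \<open>B\<close> and leaves under \<open>z\<close>.\<close>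

lemma escape_add:
  assumes "periodic B"
  shows "escape B (x + z) \<le> escape B x + escape B z"
proof -
  let ?E = "{y \<in> B. y + z \<notin> B}"
  have "?E = B \<inter> - {y. y + z \<in> B}"
    by auto
  then have "periodic ?E"
    using assms by (simp add: periodic_Int periodic_Compl periodic_translate del: Compl_iff)
  then have "size_mod {y. y + x \<in> ?E} = escape B z"
    by (simp add: size_mod_translate escape_def del: mem_Collect_eq)
  moreover have "{y \<in> B. y + (x + z) \<notin> B} \<subseteq> {y \<in> B. y + x \<notin> B} \<union> {y. y + x \<in> ?E}"
    by (auto simp: algebra_simps)
  ultimately show ?thesis
    using size_mod_mono size_mod_Un_le unfolding escape_def by (metis (no_types, lifting) order_trans)
qed

lemma escape_cong:
  assumes "periodic B" and "x mod p = z mod p"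
  shows "escape B x = escape B z"
proof -
  have "y + x \<in> B \<longleftrightarrow> y + z \<in> B" for y
    using assms(2) by (intro periodic_mem_iff[OF assms(1)]) (metis mod_add_right_eq)
  then show ?thesis
    by (simp add: escape_def)
qed

lemma escape_zero: "p dvd x \<Longrightarrow> periodic B \<Longrightarrow> escape B x = 0"
  using escape_cong[of B x 0] by (simp add: escape_def size_mod_def)

text \<open>Both sides count the pairs \<open>(x, y)\<close> with \<open>y\<close> and \<open>y + x\<close> in \<open>B\<close>.\<close>

lemma sum_sublevel_escape:
  assumes "periodic B"
  shows "(\<Sum>i<size_mod B. size_mod {x. escape B x \<le> i}) = (size_mod B)\<^sup>2"
proof -
  let ?b = "size_mod B" and ?P = "{0..<p}"
  have "(\<Sum>i<?b. size_mod {x. escape B x \<le> i}) = (\<Sum>i<?b. \<Sum>x\<in>?P. of_bool (escape B x \<le> i))"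
    by (simp add: size_mod_def Int_commute Int_def)
  also have "\<dots> = (\<Sum>x\<in>?P. \<Sum>i<?b. of_bool (escape B x \<le> i))"
    by (rule sum.swap)
  also have "\<dots> = (\<Sum>x\<in>?P. size_mod {y \<in> B. y + x \<in> B})"
  proof (rule sum.cong[OF refl])
    fix x
    have "(\<Sum>i<?b. of_bool (escape B x \<le> i)) = card {escape B x..<?b}"
      by (simp add: Int_def atLeastLessThan_def lessThan_def atLeast_def conj_commute)
    also have "\<dots> = size_mod {y \<in> B. y + x \<in> B}"
      using escape_eq_diff[of B x] size_mod_mono[of "{y \<in> B. y + x \<in> B}" B] by auto
    finally show "(\<Sum>i<?b. of_bool (escape B x \<le> i)) = size_mod {y \<in> B. y + x \<in> B}" .
  qed
  also have "\<dots> = (\<Sum>x\<in>?P. \<Sum>y\<in>B \<inter> ?P. of_bool (y + x \<in> B))"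
    by (intro sum.cong) (auto simp: size_mod_def intro!: arg_cong[where f = card])
  also have "\<dots> = (\<Sum>y\<in>B \<inter> ?P. \<Sum>x\<in>?P. of_bool (y + x \<in> B))"
    by (rule sum.swap)
  also have "\<dots> = (\<Sum>y\<in>B \<inter> ?P. size_mod {x. x + y \<in> B})"
    by (intro sum.cong) (auto simp: size_mod_def add.commute intro!: arg_cong[where f = card])
  also have "\<dots> = ?b\<^sup>2"
    by (simp add: size_mod_translate[OF assms]) (simp add: size_mod_def power2_eq_square)
  finally show ?thesis .
qed

text \<open>By subadditivity, adding an element of \<open>T\<close> to the sublevel set of
  \<open>j * M\<close> lands in that of \<open>(j + 1) * M\<close>, so Cauchy-Davenport applies once
  for each \<open>j\<close>.\<close>

lemma size_sublevel_escape:
  assumes "periodic B" and "finite T" and "inj_on (\<lambda>x. x mod p) T" and "\<And>x. x \<in> T \<Longrightarrow> \<not> p dvd x"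
    and "\<And>x. x \<in> T \<Longrightarrow> escape B x \<le> M"
  shows "min (nat p) (j * card T + 1) \<le> size_mod {x. escape B x \<le> j * M}"
proof (induction j)
  case 0
  have "periodic {x. escape B x \<le> 0}"
    by (simp add: periodic_def escape_cong[OF assms(1) mod_mod_trivial])
  then have "size_mod {x. escape B x \<le> 0} > 0"
    using escape_zero[OF dvd_0_right assms(1)] by (intro size_mod_pos) auto
  then show ?case by simp
next
  case (Suc j)
  \<comment> \<open>The extra class of 0 makes up for the loss of one in Cauchy-Davenport: each step
    gains all of \<open>card T\<close>.\<close>
  define T0 where "T0 = {x. x mod p \<in> insert 0 ((\<lambda>x. x mod p) ` T)}"
  have T0: "T0 \<inter> {0..<p} = insert 0 ((\<lambda>x. x mod p) ` T)"
    using p_pos by (auto simp: T0_def dvd_eq_mod_eq_0)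
  have size_T0: "size_mod T0 = card T + 1"
    unfolding size_mod_def T0 using assms(2,3,4) by (subst card_insert_disjoint) (auto simp: card_image dvd_eq_mod_eq_0)
  have T0_le: "escape B x \<le> M" if x: "x \<in> T0" for x
  proof (cases "p dvd x")
    case False
    then obtain t where "t \<in> T" "x mod p = t mod p"
      using x by (auto simp: T0_def dvd_eq_mod_eq_0)
    then show ?thesis
      using escape_cong[OF assms(1)] assms(5) by metis
  qed (simp add: escape_zero assms(1))
  let ?L = "\<lambda>i. {x. escape B x \<le> i}"
  have per: "periodic (?L i)" for i
    by (simp add: periodic_def escape_cong[OF assms(1) mod_mod_trivial])
  have "min (nat p) (size_mod (?L (j * M)) + size_mod T0 - 1) \<le> size_mod (?L (Suc j * M))"
  proof (rule cauchy_davenport[OF per])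
    show "periodic T0"
      by (simp add: periodic_def T0_def)
    show "?L (j * M) \<noteq> {}" "T0 \<noteq> {}"
      using escape_zero[OF dvd_0_right assms(1)] by (auto simp: T0_def intro: exI[of _ 0])
    show "x + y \<in> ?L (Suc j * M)" if "x \<in> ?L (j * M)" "y \<in> T0" for x y
      using that escape_add[OF assms(1), of x y] T0_le[of y] by simp
  qed
  then show ?case
    using Suc.IH size_T0 by simp
qed

text \<open>
  With \<open>f i\<close> the number of residues \<open>x\<close> with \<open>escape B x \<le> i\<close>, the sum of \<open>f i\<close> over \<open>i < b\<close>
  is \<open>b\<^sup>2\<close>, which is also the sum of \<open>2 * i + 1\<close>. If \<open>escape B\<close> is at most \<open>M\<close> on \<open>T\<close>, then
  \<open>f i\<close> is larger for each \<open>i \<ge> M\<^sup>2\<close>, and the total over \<open>i < M\<^sup>2\<close>, taken in blocks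
  \<open>M * J \<le> i < M * J + M\<close> of constant lower bound, is at least \<open>M ^ 4\<close>.
\<close>

lemma exists_escape_gt:
  assumes "periodic B" and "2 * size_mod B \<le> nat p" and "M\<^sup>2 < size_mod B"
    and "finite T" and "inj_on (\<lambda>x. x mod p) T" and "\<And>x. x \<in> T \<Longrightarrow> \<not> p dvd x"
    and "2 * M + 2 \<le> card T"
  shows "\<exists>x\<in>T. M < escape B x"
proof (rule ccontr)
  assume "\<not> ?thesis"
  then have le: "escape B x \<le> M" if "x \<in> T" for x
    using that by force
  define f where "f i = size_mod {x. escape B x \<le> i}" for i
  let ?b = "size_mod B"
  have f: "min (nat p) (j * (2 * M + 2) + 1) \<le> f i" if "j * M \<le> i" for i j
  proof -
    have "j * (2 * M + 2) \<le> j * card T"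
      using assms(7) by (rule mult_le_mono2)
    moreover have "size_mod {x. escape B x \<le> j * M} \<le> f i"
      unfolding f_def using that by (intro size_mod_mono) auto
    ultimately show ?thesis
      using size_sublevel_escape[OF assms(1,4-6) le, of j] by linarith
  qed
  have large: "2 * i + 2 \<le> f i" if "M\<^sup>2 \<le> i" "i < ?b" for i
  proof -
    \<comment> \<open>The quotient \<open>i div M\<close> is at least \<open>M\<close> and so
      exceeds the remainder. For \<open>M = 0\<close> the condition \<open>j * M \<le> i\<close> is
      void, and \<open>j = i + 1\<close> is large enough.\<close>
    obtain j where j: "j * M \<le> i" "2 * i + 1 \<le> j * (2 * M + 2)"
    proof (cases "M = 0")
      case True
      then show ?thesis using that[of "i + 1"] by simp
    next
      case False
      define c r where "c = i div M" and "r = i mod M"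
      have "M \<le> c"
        using False \<open>M\<^sup>2 \<le> i\<close> by (simp add: c_def less_eq_div_iff_mult_less_eq power2_eq_square)
      moreover have "i = c * M + r" "r < M"
        using False by (simp_all add: c_def r_def)
      ultimately show ?thesis
        using that[of c] by (simp add: algebra_simps)
    qed
    show ?thesis
      using f[OF j(1)] j(2) assms(2) \<open>i < ?b\<close> by linarith
  qed
  \<comment> \<open>The lower bound for the sum is \<open>M * J + M * (M + 1) * J * (J - 1)\<close>,
    written without subtraction; it is \<open>M ^ 4\<close> for \<open>J = M\<close>.\<close>
  have blocks: "M * J + M * (M + 1) * J * J \<le> (\<Sum>i<M * J. f i) + M * (M + 1) * J" if "J \<le> M" for J
    using that
  proof (induction J)
    case (Suc J)
    have "(J + 1) * (J + 1) \<le> M * M"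
      using Suc.prems by (intro mult_mono) auto
    moreover have "J * M + M \<le> M * M"
      using Suc.prems by (metis Suc_leD add.commute mult_Suc mult_le_mono1 Suc_le_eq)
    ultimately have "J * (2 * M + 2) + 1 \<le> nat p"
      using assms(2,3) Suc.prems by (simp add: algebra_simps power2_eq_square)
    then have "J * (2 * M + 2) + 1 \<le> f i" if "i \<in> {M * J..<M * J + M}" for i
      using f[of J i] that by (simp add: mult.commute)
    then have "(\<Sum>i\<in>{M * J..<M * J + M}. J * (2 * M + 2) + 1) \<le> (\<Sum>i\<in>{M * J..<M * J + M}. f i)"
      by (intro sum_mono)
    moreover have "(\<Sum>i<M * Suc J. f i) = (\<Sum>i<M * J. f i) + (\<Sum>i\<in>{M * J..<M * J + M}. f i)"
      by (simp add: lessThan_atLeast0 sum.atLeastLessThan_concat add.commute)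
    ultimately show ?case
      using Suc by (simp add: algebra_simps)
  qed simp
  \<comment> \<open>The left side grows by \<open>2 * c + 2\<close> at each step, which is the bound
    on \<open>f c\<close> in \<open>large\<close>. At \<open>c = ?b\<close> the sum is
    \<open>?b\<^sup>2\<close>, which forces \<open>?b \<le> M\<^sup>2\<close>.\<close>
  have "c\<^sup>2 + c \<le> (\<Sum>i<c. f i) + M\<^sup>2" if "M\<^sup>2 \<le> c" "c \<le> ?b" for c
    using that
  proof (induction c rule: dec_induct)
    case base
    show ?case
      using blocks[of M] by (simp add: algebra_simps power2_eq_square)
  next
    case (step c)
    then show ?case
      using large[of c] by (simp add: power2_eq_square)
  qed
  from this[of ?b] show False
    using sum_sublevel_escape[OF assms(1)] assms(3) by (simp add: f_def)
qed

section \<open>Growth of subset sums, and zero sums\<close>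

definition subset_sums :: "int set \<Rightarrow> int set" where
  "subset_sums S = {x. \<exists>A\<subseteq>S. [\<Sum>A = x] (mod p)}"

lemma periodic_subset_sums: "periodic (subset_sums S)"
  by (simp add: periodic_def subset_sums_def cong_def)

lemma zero_in_subset_sums: "0 \<in> subset_sums S"
  unfolding subset_sums_def by (intro CollectI exI[of _ "{}"]) simp

lemma subset_sums_add:
  assumes "finite S1" "finite S2" "S1 \<inter> S2 = {}" "x \<in> subset_sums S1" "y \<in> subset_sums S2"
  shows "x + y \<in> subset_sums (S1 \<union> S2)"
proof -
  obtain A1 A2 where A: "A1 \<subseteq> S1" "[\<Sum>A1 = x] (mod p)" "A2 \<subseteq> S2" "[\<Sum>A2 = y] (mod p)"
    using assms(4,5) by (auto simp: subset_sums_def)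
  then have "\<Sum>(A1 \<union> A2) = \<Sum>A1 + \<Sum>A2"
    using assms(1-3) by (intro sum.union_disjoint) (auto intro: finite_subset)
  with A have "[\<Sum>(A1 \<union> A2) = x + y] (mod p)"
    by (simp add: cong_add)
  with A show ?thesis
    unfolding subset_sums_def by blast
qed

lemma size_subset_sums_insert:
  assumes "finite S" and "x \<notin> S"
  shows "size_mod (subset_sums S) + escape (subset_sums S) x \<le> size_mod (subset_sums (insert x S))"
proof -
  have "x \<in> subset_sums {x}"
    unfolding subset_sums_def by (auto intro!: exI[of _ "{x}"])
  then have "y \<in> subset_sums (insert x S)" if "y - x \<in> subset_sums S" for y
    using subset_sums_add[of S "{x}" "y - x" x] assms that by simp
  moreover have "subset_sums S \<subseteq> subset_sums (insert x S)"
    unfolding subset_sums_def by blast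
  ultimately have "subset_sums S \<union> {y. y - x \<in> subset_sums S} \<subseteq> subset_sums (insert x S)"
    by auto
  then show ?thesis
    using size_mod_mono size_mod_Un_translate[OF periodic_subset_sums] by metis
qed

text \<open>
  The second alternative says that \<open>S\<close> has at least \<open>\<lfloor>(N + 2)\<^sup>2 / 4\<rfloor>\<close> subset sums modulo \<open>p\<close>.
\<close>

lemma subset_sums_growth:
  assumes "finite P" and "inj_on (\<lambda>x. x mod p) P" and "\<And>x. x \<in> P \<Longrightarrow> \<not> p dvd x"
    and "2 * N + 1 \<le> card P"
  shows "\<exists>S\<subseteq>P. card S \<le> N \<and>
    (nat p < 2 * size_mod (subset_sums S) \<or> (N + 2)\<^sup>2 \<le> 4 * size_mod (subset_sums S) + 1)"
  using assms(4)
proof (induction N)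
  case 0
  have "size_mod (subset_sums {}) > 0"
    using size_mod_pos[OF periodic_subset_sums] zero_in_subset_sums by blast
  then show ?case
    by (intro exI[of _ "{}"]) (simp add: power2_eq_square)
next
  case (Suc N)
  then obtain S where S: "S \<subseteq> P" "card S \<le> N"
    and S_or: "nat p < 2 * size_mod (subset_sums S) \<or> (N + 2)\<^sup>2 \<le> 4 * size_mod (subset_sums S) + 1"
    by auto
  let ?b = "size_mod (subset_sums S)"
  show ?case
  proof (cases "nat p < 2 * ?b")
    case True
    with S show ?thesis by (auto intro!: exI[of _ S])
  next
    case False
    with S_or have sq: "(N + 2)\<^sup>2 \<le> 4 * ?b + 1"
      by simp
    \<comment> \<open>Outside \<open>S\<close> at least \<open>N + 3 \<ge> 2 * M + 2\<close>
      elements of \<open>P\<close> remain, and a gain of \<open>M + 1\<close> is exactly the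
      increase from \<open>\<lfloor>(N + 2)\<^sup>2 / 4\<rfloor>\<close> to
      \<open>\<lfloor>(N + 3)\<^sup>2 / 4\<rfloor>\<close>.\<close>
    define M where "M = (N + 1) div 2"
    have fin: "finite S"
      using S(1) assms(1) finite_subset by blast
    have "2 * M \<le> N + 1"
      unfolding M_def by simp
    have "N = 2 * M \<or> N + 1 = 2 * M"
      unfolding M_def by linarith
    then have M: "M\<^sup>2 < ?b \<and> (N + 3)\<^sup>2 \<le> 4 * (?b + M + 1) + 1"
    proof
      assume N: "N = 2 * M"
      have "4 * (M + 1)\<^sup>2 \<le> 4 * ?b + 1"
        using sq by (simp add: N power2_eq_square algebra_simps)
      then have "(M + 1)\<^sup>2 \<le> ?b"
        by presburger
      then show ?thesis
        by (simp add: N power2_eq_square algebra_simps)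
    next
      assume "N + 1 = 2 * M"
      then have N2: "N + 2 = 2 * M + 1" and N3: "N + 3 = 2 * M + 2" and "M > 0"
        by auto
      show ?thesis
        using sq \<open>M > 0\<close> unfolding N2 N3 by (simp add: power2_eq_square algebra_simps)
    qed
    have "\<exists>x\<in>P - S. M < escape (subset_sums S) x"
    proof (rule exists_escape_gt[OF periodic_subset_sums])
      show "2 * M + 2 \<le> card (P - S)"
        using card_Diff_subset[OF fin S(1)] S(2) Suc.prems \<open>2 * M \<le> N + 1\<close> by simp
      show "inj_on (\<lambda>x. x mod p) (P - S)"
        using assms(2) by (rule inj_on_diff)
    qed (use False M assms(1,3) in auto)
    then obtain x where x: "x \<in> P" "x \<notin> S" "M < escape (subset_sums S) x"
      by auto
    have "(Suc N + 2)\<^sup>2 \<le> 4 * size_mod (subset_sums (insert x S)) + 1"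
      using size_subset_sums_insert[OF fin x(2)] x(3) M by (simp add: numeral_3_eq_3)
    moreover have "card (insert x S) \<le> Suc N"
      using S(2) fin x(2) by simp
    ultimately show ?thesis
      using S(1) x(1) by (intro exI[of _ "insert x S"]) auto
  qed
qed

text \<open>For such \<open>N\<close>, either alternative of the growth lemma yields more than
  \<open>p / 2\<close> sums. It is applied twice, the second time to the at least
  \<open>2 * N + 1\<close> elements left over, and Cauchy-Davenport joins the two sets.\<close>

lemma exists_subset_sums_UNIV:
  assumes "finite P" and "inj_on (\<lambda>x. x mod p) P" and "\<And>x. x \<in> P \<Longrightarrow> \<not> p dvd x"
    and "3 * N + 1 \<le> card P" and "2 * nat p + 1 < (N + 2)\<^sup>2"
  shows "\<exists>S\<subseteq>P. card S \<le> 2 * N \<and> subset_sums S = UNIV"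
proof -
  obtain S1 where S1: "S1 \<subseteq> P" "card S1 \<le> N" "nat p < 2 * size_mod (subset_sums S1)"
    using subset_sums_growth[OF assms(1-3), of N] assms(4,5) by fastforce
  have fin1: "finite S1"
    using S1(1) assms(1) finite_subset by blast
  have "2 * N + 1 \<le> card (P - S1)"
    using card_Diff_subset[OF fin1 S1(1)] S1(2) assms(4) by linarith
  moreover have "inj_on (\<lambda>x. x mod p) (P - S1)"
    using assms(2) by (rule inj_on_diff)
  ultimately obtain S2 where S2: "S2 \<subseteq> P - S1" "card S2 \<le> N" "nat p < 2 * size_mod (subset_sums S2)"
    using subset_sums_growth[of "P - S1" N] assms(1,3,5) by fastforce
  have fin2: "finite S2"
    using S2(1) assms(1) finite_subset by blast
  have "min (nat p) (size_mod (subset_sums S1) + size_mod (subset_sums S2) - 1)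
      \<le> size_mod (subset_sums (S1 \<union> S2))"
    using zero_in_subset_sums fin1 fin2 S2(1)
    by (intro cauchy_davenport periodic_subset_sums subset_sums_add) auto
  then have "nat p \<le> size_mod (subset_sums (S1 \<union> S2))"
    using S1(3) S2(3) by linarith
  then have "subset_sums (S1 \<union> S2) \<inter> {0..<p} = {0..<p}"
    unfolding size_mod_def by (intro card_seteq) auto
  then have "x \<in> subset_sums (S1 \<union> S2)" for x
    using periodic_subset_sums p_pos unfolding periodic_def
    by (metis IntD1 atLeastLessThan_iff pos_mod_bound pos_mod_sign)
  moreover have "card (S1 \<union> S2) \<le> 2 * N"
    using card_Un_le[of S1 S2] S1(2) S2(2) by linarith
  ultimately show ?thesis
    using S1(1) S2(1) by (intro exI[of _ "S1 \<union> S2"]) auto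
qed

text \<open>
  If \<open>X i \<subseteq> S1\<close> and \<open>Y i \<subseteq> S2\<close> have sums \<open>i * b\<close> and \<open>- (i + 1) * b\<close> modulo \<open>p\<close>, then
  \<open>X i \<union> Y i \<union> {b}\<close> and \<open>X (i + 1) \<union> Y i\<close> have sum zero modulo \<open>p\<close>, hence modulo \<open>q\<close>.
\<close>

lemma dvd_mult_of_zero_sums:
  assumes "finite S1" "finite S2" "S1 \<inter> S2 = {}" "b \<notin> S1" "b \<notin> S2"
    and "subset_sums S1 = UNIV" "subset_sums S2 = UNIV"
    and zero: "\<And>A. A \<subseteq> insert b (S1 \<union> S2) \<Longrightarrow> p dvd \<Sum>A \<Longrightarrow> q dvd \<Sum>A"
  shows "q dvd p * b"
proof -
  have "\<exists>A\<subseteq>S1. [\<Sum>A = int i * b] (mod p)" for i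
    using assms(6) unfolding subset_sums_def by blast
  then obtain X where X: "\<And>i. X i \<subseteq> S1" "\<And>i. [\<Sum>(X i) = int i * b] (mod p)"
    by metis
  have "\<exists>A\<subseteq>S2. [\<Sum>A = - (int i + 1) * b] (mod p)" for i
    using assms(7) unfolding subset_sums_def by blast
  then obtain Y where Y: "\<And>i. Y i \<subseteq> S2" "\<And>i. [\<Sum>(Y i) = - (int i + 1) * b] (mod p)"
    by metis
  have fin: "finite (X i)" "finite (Y i)" for i
    by (rule finite_subset[OF X(1) assms(1)]) (rule finite_subset[OF Y(1) assms(2)])
  have un: "\<Sum>(X i \<union> Y j) = \<Sum>(X i) + \<Sum>(Y j)" for i j
    using X(1)[of i] Y(1)[of j] assms(3) fin by (intro sum.union_disjoint) auto
  have ins: "\<Sum>(insert b (X i \<union> Y j)) = b + (\<Sum>(X i) + \<Sum>(Y j))" for i j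
    using X(1)[of i] Y(1)[of j] assms(4,5) fin un by (subst sum.insert) auto
  have step: "q dvd \<Sum>(X (Suc i)) - (\<Sum>(X i) + b)" for i
  proof -
    have "[b + (\<Sum>(X i) + \<Sum>(Y i)) = b + (int i * b + - (int i + 1) * b)] (mod p)"
      by (intro cong_add cong_refl X(2) Y(2))
    then have "p dvd \<Sum>(insert b (X i \<union> Y i))"
      unfolding ins by (simp add: cong_0_iff algebra_simps)
    then have 1: "q dvd \<Sum>(insert b (X i \<union> Y i))"
      using X(1)[of i] Y(1)[of i] by (intro zero) auto
    have "[\<Sum>(X (Suc i)) + \<Sum>(Y i) = int (Suc i) * b + - (int i + 1) * b] (mod p)"
      by (intro cong_add X(2) Y(2))
    then have "p dvd \<Sum>(X (Suc i) \<union> Y i)"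
      unfolding un by (simp add: cong_0_iff algebra_simps)
    then have 2: "q dvd \<Sum>(X (Suc i) \<union> Y i)"
      using X(1)[of "Suc i"] Y(1)[of i] by (intro zero) auto
    show ?thesis
      using dvd_diff[OF 2 1] unfolding un ins by (simp add: algebra_simps)
  qed
  have "q dvd \<Sum>(X n) - (\<Sum>(X 0) + int n * b)" for n
  proof (induction n)
    case (Suc n)
    from dvd_add[OF this step[of n]] show ?case
      by (simp add: algebra_simps)
  qed simp
  from this[of "nat p"] have diff: "q dvd \<Sum>(X (nat p)) - (\<Sum>(X 0) + p * b)"
    using p_pos by simp
  have ends: "q dvd \<Sum>(X (nat p))" "q dvd \<Sum>(X 0)"
    using X(2)[of "nat p"] X(2)[of 0] X(1)[of "nat p"] X(1)[of 0] p_pos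
    by (auto intro!: zero simp: cong_def mod_eq_0_iff_dvd)
  show ?thesis
    using dvd_diff[OF dvd_diff[OF ends] diff] by simp
qed

end

section \<open>Choice of the two covering sets\<close>

theorem theorem1p2:
  fixes p m q :: int and n :: nat and B :: "int set"
  assumes "prime p" and "m > 1" and "q = p * m"
    and "B \<subseteq> carrier (residue_ring q)" and "card B = n"
    and "int (card ((\<lambda>b. b mod p) ` B)) > 4 * \<lceil>2 * sqrt (real_of_int p)\<rceil>"
    and "\<exists>b\<in>B. \<not> m dvd b"
  shows "\<exists>A\<subseteq>B. [residue_sum q A = 0] (mod p) \<and> \<not> [residue_sum q A = 0] (mod q)"
proof (rule ccontr)
  assume contra: "\<not> ?thesis"
  interpret prime_modulus p
    using assms(1) by unfold_locales
  obtain b where b: "b \<in> B" "\<not> m dvd b"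
    using assms(7) by auto
  have "p > 1"
    using assms(1) prime_gt_1_int by blast
  then have "q > 1"
    using assms(2,3) by (simp add: less_1_mult)
  have finB: "finite B"
    using assms(4) finite_subset by (auto simp: residue_ring_def)
  have zero: "q dvd \<Sum>A" if "A \<subseteq> B" "p dvd \<Sum>A" for A
  proof -
    have eq: "residue_sum q A = \<Sum>A mod q"
      using residue_sum_eq[OF \<open>q > 1\<close>, of A] that(1) assms(4) by simp
    then have "[residue_sum q A = 0] (mod p)"
      using that(2) assms(3) by (simp add: cong_0_iff dvd_mod)
    then have "q dvd residue_sum q A"
      using contra that(1) by (auto simp: cong_0_iff)
    then show ?thesis
      by (simp add: eq dvd_eq_mod_eq_0)
  qed
  define k where "k = nat \<lceil>2 * sqrt (real_of_int p)\<rceil>"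
  have "0 \<le> \<lceil>2 * sqrt (real_of_int p)\<rceil>"
    using p_pos by (simp add: le_ceiling_iff less_le_trans[of "-1" 0])
  then have k_eq: "int k = \<lceil>2 * sqrt (real_of_int p)\<rceil>"
    by (simp add: k_def)
  have "2 * sqrt (real_of_int p) \<le> real k"
    unfolding k_def by (simp add: of_nat_ceiling)
  then have "(2 * sqrt (real_of_int p))\<^sup>2 \<le> (real k)\<^sup>2"
    using p_pos by (intro power_mono) auto
  then have "4 * real_of_int p \<le> real_of_int ((int k)\<^sup>2)"
    using p_pos by (simp add: power_mult_distrib)
  then have k: "4 * p \<le> (int k)\<^sup>2"
    by linarith
  \<comment> \<open>Dropping the class of 0 leaves nonzero residues, and dropping that of
    \<open>b\<close> keeps \<open>b\<close> outside both sets.\<close>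
  define I where "I = (\<lambda>b. b mod p) ` B - {0, b mod p}"
  have "4 * k < card ((\<lambda>b. b mod p) ` B)"
    using assms(6) unfolding k_eq[symmetric] by linarith
  moreover have "card ((\<lambda>b. b mod p) ` B) \<le> card I + card {0, b mod p}"
    unfolding I_def using diff_card_le_card_Diff[of "{0, b mod p}" "(\<lambda>b. b mod p) ` B"] by simp
  moreover have "card {0, b mod p} \<le> 2"
    by (simp add: card_insert_if)
  ultimately have cardI: "4 * k \<le> card I + 1"
    by linarith
  obtain P where P: "P \<subseteq> B" "inj_on (\<lambda>b. b mod p) P" "I = (\<lambda>b. b mod p) ` P"
    using subset_image_inj[of I "\<lambda>b. b mod p" B] by (auto simp: I_def)
  have P_nz: "\<not> p dvd x" if "x \<in> P" for x
    using that P(3) by (auto simp: I_def dvd_eq_mod_eq_0)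
  have "b \<notin> P"
    using P(3) by (auto simp: I_def)
  have finP: "finite P"
    using P(1) finB finite_subset by blast
  have cardP: "4 * k \<le> card P + 1"
    using cardI P(2,3) by (simp add: card_image)
  \<comment> \<open>The largest \<open>N\<close> that \<open>card P \<ge> 4 * k - 1\<close> allows:
    \<open>S1\<close> uses up to \<open>2 * N\<close> elements and \<open>S2\<close> needs
    \<open>3 * N + 1\<close> more. Since \<open>N + 2\<close> is at least
    \<open>4 * (k + 1) / 5\<close>, its square still exceeds \<open>2 * p + 1\<close>.\<close>
  define N where "N = (4 * k - 2) div 5"
  have "k > 0"
    using k p_pos by (cases "k = 0") auto
  then have N: "5 * N + 1 \<le> card P" "4 * k + 4 \<le> 5 * (N + 2)"
    using cardP \<open>k > 0\<close> unfolding N_def by presburger+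
  have "(4 * k + 4)\<^sup>2 \<le> (5 * (N + 2))\<^sup>2"
    using N(2) by (intro power_mono) auto
  moreover have "4 * nat p \<le> k\<^sup>2"
    using k p_pos by (simp add: nat_le_iff nat_mult_distrib[symmetric] flip: of_nat_le_iff[where 'a = int])
  ultimately have sq: "2 * nat p + 1 < (N + 2)\<^sup>2"
    using \<open>k > 0\<close> by (simp add: power2_eq_square algebra_simps)
  obtain S1 where S1: "S1 \<subseteq> P" "card S1 \<le> 2 * N" "subset_sums S1 = UNIV"
    using exists_subset_sums_UNIV[OF finP P(2) P_nz _ sq] N(1) by auto
  have fin1: "finite S1"
    using S1(1) finP finite_subset by blast
  have "3 * N + 1 \<le> card (P - S1)"
    using card_Diff_subset[OF fin1 S1(1)] S1(2) N(1) by linarith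
  then obtain S2 where S2: "S2 \<subseteq> P - S1" "subset_sums S2 = UNIV"
    using exists_subset_sums_UNIV[of "P - S1" N] finP P(2) P_nz sq inj_on_diff by blast
  have "q dvd p * b"
  proof (rule dvd_mult_of_zero_sums[of S1 S2 b])
    show "finite S2"
      using S2(1) finP finite_subset by blast
    show "q dvd \<Sum>A" if "A \<subseteq> insert b (S1 \<union> S2)" "p dvd \<Sum>A" for A
      using that S1(1) S2(1) P(1) b(1) by (intro zero) auto
  qed (use fin1 S1 S2 \<open>b \<notin> P\<close> in auto)
  then show False
    using b(2) assms(3) p_pos by simp
qed

end
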